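(* There exists a polynomial map $\Phi:\mathrm{Alt}_5^{\oplus 4}\to\mathrm{Sym}^2(\mathbb{C}^4)$ such that $$\Phi(\rho(A,B)X)=(\det B)^2\,B\,\Phi(X)\,{}^tB$$ for $X\in\mathrm{Alt}_5^{\oplus 4}$ and $(A,B)\in SL_5\times GL_4$.
   Context: Everything is over $\mathbb{C}$. $\mathrm{Alt}_5$ is the space of skew-symmetric complex $5\times 5$ matrices, and $\mathrm{Alt}_5^{\oplus 4}$ is the space of quadruples $X=(X_1,X_2,X_3,X_4)$ of such matrices (isomorphic to $(\wedge^2\mathbb{C}^5)\otimes\mathbb{C}^4$). $\mathrm{Sym}^2(\mathbb{C}^4)$ is identified with the space of symmetric complex $4\times 4$ matrices. ${}^tM$ denotes the transpose of $M$. $\rho$ is the representation of $SL_5\times GL_4$ on $\mathrm{Alt}_5^{\oplus 4}$ given by $$\rho(A,B)(X_1,X_2,X_3,X_4)=(AX_1{}^tA,\,AX_2{}^tA,\,AX_3{}^tA,\,AX_4{}^tA)\,{}^tB,$$ i.e. the $k$-th component of $\rho(A,B)(X_1,\dots,X_4)$ is $\sum_{j=1}^4 B_{kj}\,AX_j{}^tA$. *)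

theory Defs
  imports "HOL-Analysis.Analysis"
begin

definition Alt5_4 :: "(complex^5^5^4) set" where
  "Alt5_4 = {X. \<forall>k. transpose (X $ k) = - (X $ k)}"

definition Sym4 :: "(complex^4^4) set" where
  "Sym4 = {M. transpose M = M}"

definition SL5 :: "(complex^5^5) set" where
  "SL5 = {A. det A = 1}"

definition GL4 :: "(complex^4^4) set" where
  "GL4 = {B. invertible B}"

text \<open>\<open>mat c ** M\<close> is the scalar multiple of the matrix M by c.\<close>

definition rho :: "complex^5^5 \<Rightarrow> complex^4^4 \<Rightarrow> complex^5^5^4 \<Rightarrow> complex^5^5^4" where
  "rho A B X = (\<chi> k. \<Sum>j\<in>UNIV. mat (B $ k $ j) ** (A ** X $ j ** transpose A))"

text \<open>
  Polynomials over the complex numbers in the matrix entries. The library's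
  polynomial_function means polynomial over the reals and therefore also admits complex
  conjugates of entries.
\<close>

inductive complex_polynomial_function :: "(complex^5^5^4 \<Rightarrow> complex) \<Rightarrow> bool" where
  const: "complex_polynomial_function (\<lambda>X. c)"
| entry: "complex_polynomial_function (\<lambda>X. X $ k $ i $ j)"
| add: "complex_polynomial_function f \<Longrightarrow> complex_polynomial_function g
    \<Longrightarrow> complex_polynomial_function (\<lambda>X. f X + g X)"
| mult: "complex_polynomial_function f \<Longrightarrow> complex_polynomial_function g
    \<Longrightarrow> complex_polynomial_function (\<lambda>X. f X * g X)"

text \<open>
  A polynomial map on the linear subspace Alt5_4 is the restriction of a polynomial map on
  the ambient space. The values of \<open>\<Phi>\<close> outside Alt5_4 are irrelevant.
\<close>

definition polynomial_map_Alt5_4_Sym4 :: "(complex^5^5^4 \<Rightarrow> complex^4^4) \<Rightarrow> bool" where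
  "polynomial_map_Alt5_4_Sym4 \<Phi> \<longleftrightarrow>
     \<Phi> ` Alt5_4 \<subseteq> Sym4 \<and>
     (\<forall>i j. \<exists>f. complex_polynomial_function f \<and> (\<forall>X\<in>Alt5_4. \<Phi> X $ i $ j = f X))"

end

theory Submission
  imports Defs
begin

text \<open>
  The map is built from $X$ by contractions with the two volume forms, in three steps, each of
  which is visibly equivariant.

  Write $V = \mathbf{C}^5$. The exterior product of two elements $x, y$ of $\wedge^2 V$ lies in
  $\wedge^4 V$, which the volume form identifies with the dual of $V$; this gives a covector
  \<open>wedge x y\<close> (five polarized $4\times 4$ Pfaffians). A third element $z$ of $\wedge^2 V$ is a
  bilinear form on covectors, so five skew matrices have the $SL_5$-invariant
  $z(x \wedge y, u \wedge v)$, called \<open>quintic x y z u v\<close>.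

  Evaluating \<open>quintic\<close> on the components of $X$ produces a tensor with five indices in
  $\mathbf{C}^4$, on which $GL_4$ acts only. Contracting three of them with the volume form of
  $\mathbf{C}^4$ leaves two lower indices $i, j$ and one upper index $m$,
  $$\psi_{ij}^m = \sum_{k,l,p} \epsilon^{mklp}\, X_l(X_i \wedge X_k,\; X_j \wedge X_p).$$
  For fixed $i$ this is a $4 \times 4$ matrix $\Psi_i$, \<open>quintic_mat X i\<close>, and the contraction
  costs one factor $\det B$: replacing $X$ by $X\,{}^tB$ turns $\Psi_i$ into
  $\det B \cdot \sum_{i'} B_{ii'}\, B \Psi_{i'} B^{-1}$. Therefore the trace form
  $\Phi_{ij} = \mathrm{tr}(\Psi_i \Psi_j)$, of degree ten, is symmetric and transforms by
  $(\det B)^2 B \Phi\, {}^tB$ (lemma \<open>covariant_mix\<close>).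

  That $\Phi$ does not vanish is seen at
  $X = (e_2 \wedge e_3,\; e_3 \wedge e_1,\; e_1 \wedge e_2,\; e_4 \wedge e_5)$, where the only
  nonzero products are $X_k \wedge X_4$ for $k \le 3$, multiples of the covectors dual to $e_k$. There
  $\Psi_4$ is the diagonal matrix with entries $-32, -32, -32, 96$.
\<close>

section \<open>The Levi-Civita symbol and its contractions\<close>

text \<open>
  The symbol is a determinant and is defined on all maps, not only on permutations. Sums over the
  type of all index maps then match the multilinear expansion of a determinant.
\<close>

definition eps :: "('n::finite \<Rightarrow> 'n) \<Rightarrow> complex" where
  "eps f = det ((\<chi> i. axis (f i) 1) :: complex^'n^'n)"

text \<open>
  Invariance of the volume form up to the determinant: both sides are the determinant of the
  matrix whose rows are the columns of \<open>A\<close> numbered by \<open>g\<close>, once expanded by multilinearity and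
  once factored as a product of matrices.
\<close>

lemma eps_contract:
  fixes A :: "complex^'n^'n"
  shows "(\<Sum>f\<in>UNIV. eps f * (\<Prod>i\<in>UNIV. A $ f i $ g i)) = det A * eps g"
proof -
  let ?M = "\<chi> i. \<Sum>k\<in>UNIV. A $ k $ g i *s (axis k 1 :: complex^'n)"
  have "?M = (\<chi> i. axis (g i) 1) ** transpose A"
    by (simp add: vec_eq_iff matrix_matrix_mult_def transpose_def axis_def if_distrib if_distribR
        cong: if_cong)
  hence "det ?M = det A * eps g"
    by (simp add: det_mul eps_def mult.commute)
  moreover have "det ?M = (\<Sum>f\<in>UNIV. eps f * (\<Prod>i\<in>UNIV. A $ f i $ g i))"
    by (simp add: det_linear_rows_sum det_rows_mul eps_def mult.commute)
  ultimately show ?thesis by simp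
qed

lemma eps_contract_tensor:
  fixes A :: "complex^'n^'n"
  shows "(\<Sum>f\<in>UNIV. eps f * (\<Sum>g\<in>UNIV. (\<Prod>i\<in>UNIV. A $ f i $ g i) * t g))
       = det A * (\<Sum>g\<in>UNIV. eps g * t g)"
proof -
  have "(\<Sum>f\<in>UNIV. eps f * (\<Sum>g\<in>UNIV. (\<Prod>i\<in>UNIV. A $ f i $ g i) * t g))
      = (\<Sum>g\<in>UNIV. (\<Sum>f\<in>UNIV. eps f * (\<Prod>i\<in>UNIV. A $ f i $ g i)) * t g)"
    unfolding sum_distrib_left sum_distrib_right by (subst sum.swap) (simp add: mult.assoc)
  thus ?thesis by (simp add: eps_contract sum_distrib_left mult.assoc)
qed

lemma sum_fibre:
  fixes F :: "('a::finite \<Rightarrow> 'b::finite) \<Rightarrow> complex"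
  shows "(\<Sum>i\<in>UNIV. (\<Sum>f | f a = i. F f) * c i) = (\<Sum>f\<in>UNIV. F f * c (f a))"
proof -
  have "(\<Sum>i\<in>UNIV. (\<Sum>f | f a = i. F f) * c i)
      = (\<Sum>i\<in>UNIV. \<Sum>f | f \<in> UNIV \<and> f a = i. F f * c (f a))"
    by (simp add: sum_distrib_right)
  thus ?thesis by (simp only:) (rule sum.group; simp)
qed

text \<open>
  Contracting all indices but one with the volume form yields a vector with one index of the dual
  type. It cannot be transformed by \<open>A\<close> without an inverse, so \<open>A\<close> is multiplied onto the free
  index instead, which completes the product over all indices. The hypothesis says that \<open>F\<close> is
  the tensor \<open>G\<close> with \<open>A\<close> applied to every index except \<open>a\<close>.
\<close>

lemma eps_contract_free_index:
  fixes A :: "complex^'n^'n"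
  assumes "\<And>f. F f * A $ f a $ k
    = (\<Sum>g\<in>UNIV. (\<Prod>i\<in>UNIV. A $ f i $ g i) * (if g a = k then G g else 0))"
  shows "((\<chi> i. \<Sum>f | f a = i. eps f * F f) v* A) $ k = det A * (\<Sum>g | g a = k. eps g * G g)"
proof -
  have "((\<chi> i. \<Sum>f | f a = i. eps f * F f) v* A) $ k = (\<Sum>f\<in>UNIV. eps f * (F f * A $ f a $ k))"
    by (simp add: vector_matrix_mult_def sum_fibre mult.assoc)
  also have "\<dots> = det A * (\<Sum>g\<in>UNIV. eps g * (if g a = k then G g else 0))"
    by (simp only: assms eps_contract_tensor)
  also have "(\<Sum>g\<in>UNIV. eps g * (if g a = k then G g else 0)) = (\<Sum>g | g a = k. eps g * G g)"
    unfolding if_distrib[of "(*) (eps _)"] mult_zero_right by (simp add: sum.If_cases)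
  finally show ?thesis .
qed

lemma eps_not_inj: "f i = f j \<Longrightarrow> i \<noteq> j \<Longrightarrow> eps f = 0"
  unfolding eps_def by (rule det_identical_rows[of i j]) (auto simp: row_def vec_eq_iff)

lemma eps_permute:
  fixes f :: "'n::finite \<Rightarrow> 'n"
  shows "p permutes UNIV \<Longrightarrow> eps (f \<circ> p) = of_int (sign p) * eps f"
  using det_permute_rows[of p "(\<chi> i. axis (f i) 1) :: complex^'n^'n"] by (simp add: eps_def)

lemma eps_id: "eps (\<lambda>i::'n::finite. i) = 1"
proof -
  have "((\<chi> i. axis i 1) :: complex^'n^'n) = mat 1" by (simp add: vec_eq_iff axis_def mat_def)
  thus ?thesis by (simp add: eps_def)
qed

lemma eps_swap:
  assumes "i \<noteq> j" "g i = f j" "g j = f i" "\<forall>k. k \<noteq> i \<longrightarrow> k \<noteq> j \<longrightarrow> g k = f k"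
  shows "eps g = - eps f"
proof -
  have "g = f \<circ> Transposition.transpose i j"
    using assms by (auto simp: fun_eq_iff Transposition.transpose_def)
  thus ?thesis using assms(1)
    by (simp add: eps_permute permutes_swap_id sign_swap_id)
qed

section \<open>Index maps on four and five indices\<close>

lemma exhaust_5:
  fixes x :: 5
  shows "x = 1 \<or> x = 2 \<or> x = 3 \<or> x = 4 \<or> x = 5"
proof (induct x)
  case (of_int z)
  then have "0 \<le> z" and "z < 5" by simp_all
  then have "z = 0 \<or> z = 1 \<or> z = 2 \<or> z = 3 \<or> z = 4" by arith
  then show ?case by auto
qed

lemma forall_5: "(\<forall>i::5. P i) \<longleftrightarrow> P 1 \<and> P 2 \<and> P 3 \<and> P 4 \<and> P 5"
  by (metis exhaust_5)

lemma UNIV_5: "UNIV = {1, 2, 3, 4, 5::5}"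
  using exhaust_5 by auto

lemma prod_4: "prod f (UNIV :: 4 set) = f 1 * f 2 * f 3 * f 4"
  unfolding UNIV_4 by (simp add: ac_simps)

lemma prod_5: "prod f (UNIV :: 5 set) = f 1 * f 2 * f 3 * f 4 * f 5"
  unfolding UNIV_5 by (simp add: ac_simps)

definition tup4 :: "'a \<Rightarrow> 'a \<Rightarrow> 'a \<Rightarrow> 'a \<Rightarrow> 4 \<Rightarrow> 'a" where
  "tup4 a b c d = (\<lambda>i. if i = 1 then a else if i = 2 then b else if i = 3 then c else d)"

definition tup5 :: "'a \<Rightarrow> 'a \<Rightarrow> 'a \<Rightarrow> 'a \<Rightarrow> 'a \<Rightarrow> 5 \<Rightarrow> 'a" where
  "tup5 a b c d e = (\<lambda>i. if i = 1 then a else if i = 2 then b else if i = 3 then c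
     else if i = 4 then d else e)"

lemma tup4_simps [simp]:
  "tup4 a b c d 1 = a" "tup4 a b c d 2 = b" "tup4 a b c d 3 = c" "tup4 a b c d 4 = d"
  by (simp_all add: tup4_def)

lemma tup5_simps [simp]:
  "tup5 a b c d e 1 = a" "tup5 a b c d e 2 = b" "tup5 a b c d e 3 = c"
  "tup5 a b c d e 4 = d" "tup5 a b c d e 5 = e"
  by (simp_all add: tup5_def)

lemma tup4_eta: "tup4 (f 1) (f 2) (f 3) (f 4) = f"
  by (simp add: fun_eq_iff forall_4)

lemma tup5_eta: "tup5 (f 1) (f 2) (f 3) (f 4) (f 5) = f"
  by (simp add: fun_eq_iff forall_5)

lemma sum_fun4:
  fixes F :: "(4 \<Rightarrow> 'b::finite) \<Rightarrow> 'c::comm_monoid_add"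
  shows "(\<Sum>f\<in>UNIV. F f)
    = (\<Sum>a\<in>UNIV. \<Sum>b\<in>UNIV. \<Sum>c\<in>UNIV. \<Sum>d\<in>UNIV. F (tup4 a b c d))"
proof -
  have "(\<Sum>f\<in>UNIV. F f) = (\<Sum>(a,b,c,d)\<in>UNIV. F (tup4 a b c d))"
    by (rule sum.reindex_bij_witness
        [of _ "\<lambda>(a,b,c,d). tup4 a b c d" "\<lambda>f. (f 1, f 2, f 3, f 4)"])
      (auto simp: tup4_eta)
  thus ?thesis
    by (simp add: sum.cartesian_product flip: UNIV_Times_UNIV)
qed

lemma sum_fun5:
  fixes F :: "(5 \<Rightarrow> 'b::finite) \<Rightarrow> 'c::comm_monoid_add"
  shows "(\<Sum>f\<in>UNIV. F f)
    = (\<Sum>a\<in>UNIV. \<Sum>b\<in>UNIV. \<Sum>c\<in>UNIV. \<Sum>d\<in>UNIV. \<Sum>e\<in>UNIV. F (tup5 a b c d e))"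
proof -
  have "(\<Sum>f\<in>UNIV. F f) = (\<Sum>(a,b,c,d,e)\<in>UNIV. F (tup5 a b c d e))"
    by (rule sum.reindex_bij_witness
        [of _ "\<lambda>(a,b,c,d,e). tup5 a b c d e" "\<lambda>f. (f 1, f 2, f 3, f 4, f 5)"])
      (auto simp: tup5_eta)
  thus ?thesis
    by (simp add: sum.cartesian_product flip: UNIV_Times_UNIV)
qed

lemma sum_fun4_fibre:
  fixes F :: "(4 \<Rightarrow> 'b::finite) \<Rightarrow> complex"
  shows "(\<Sum>f | f 1 = a. F f) = (\<Sum>b\<in>UNIV. \<Sum>c\<in>UNIV. \<Sum>d\<in>UNIV. F (tup4 a b c d))"
proof -
  have "(\<Sum>f | f 1 = a. F f) = (\<Sum>f\<in>UNIV. if f 1 = a then F f else 0)"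
    by (simp add: sum.If_cases)
  also have "\<dots> = (\<Sum>a'\<in>UNIV. if a' = a
      then \<Sum>b\<in>UNIV. \<Sum>c\<in>UNIV. \<Sum>d\<in>UNIV. F (tup4 a' b c d) else 0)"
    unfolding sum_fun4 by (intro sum.cong refl) simp
  finally show ?thesis by simp
qed

lemma sum_fun5_fibre:
  fixes F :: "(5 \<Rightarrow> 'b::finite) \<Rightarrow> complex"
  shows "(\<Sum>f | f 1 = a. F f)
    = (\<Sum>b\<in>UNIV. \<Sum>c\<in>UNIV. \<Sum>d\<in>UNIV. \<Sum>e\<in>UNIV. F (tup5 a b c d e))"
proof -
  have "(\<Sum>f | f 1 = a. F f) = (\<Sum>f\<in>UNIV. if f 1 = a then F f else 0)"
    by (simp add: sum.If_cases)
  also have "\<dots> = (\<Sum>a'\<in>UNIV. if a' = a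
      then \<Sum>b\<in>UNIV. \<Sum>c\<in>UNIV. \<Sum>d\<in>UNIV. \<Sum>e\<in>UNIV. F (tup5 a' b c d e) else 0)"
    unfolding sum_fun5 by (intro sum.cong refl) simp
  finally show ?thesis by simp
qed

section \<open>The quintic invariant of five skew matrices\<close>

text \<open>
  For skew \<open>x\<close> and \<open>y\<close> the components are, up to sign and a factor eight, the polarized Pfaffians
  of the principal $4\times 4$ submatrices.
\<close>

definition wedge :: "complex^5^5 \<Rightarrow> complex^5^5 \<Rightarrow> complex^5" where
  "wedge x y = (\<chi> i. \<Sum>f | f 1 = i. eps f * (x $ f 2 $ f 3 * y $ f 4 $ f 5))"

lemma congruence_entry:
  fixes x :: "complex^'n^'n"
  shows "(A ** x ** transpose A) $ a $ b = (\<Sum>c\<in>UNIV. \<Sum>d\<in>UNIV. A $ a $ c * A $ b $ d * x $ c $ d)"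
  unfolding matrix_matrix_mult_def transpose_def
  by (simp add: sum_distrib_right) (subst sum.swap, simp add: mult_ac)

lemma wedge_congruence:
  "wedge (A ** x ** transpose A) (A ** y ** transpose A) v* A = det A *s wedge x y"
proof -
  { fix k
    have "(A ** x ** transpose A) $ f 2 $ f 3 * (A ** y ** transpose A) $ f 4 $ f 5 * A $ f 1 $ k
      = (\<Sum>g\<in>UNIV. (\<Prod>i\<in>UNIV. A $ f i $ g i)
           * (if g 1 = k then x $ g 2 $ g 3 * y $ g 4 $ g 5 else 0))" for f :: "5 \<Rightarrow> 5"
    proof -
      let ?t = "\<lambda>a b c d e. A $ f 1 $ a * (A $ f 2 $ b * (A $ f 3 $ c * (A $ f 4 $ d * A $ f 5 $ e)))
            * (x $ b $ c * y $ d $ e)"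
      have "(A ** x ** transpose A) $ f 2 $ f 3 * (A ** y ** transpose A) $ f 4 $ f 5 * A $ f 1 $ k
          = (\<Sum>b\<in>UNIV. \<Sum>c\<in>UNIV. \<Sum>d\<in>UNIV. \<Sum>e\<in>UNIV. ?t k b c d e)"
        unfolding congruence_entry sum_distrib_right
        unfolding sum_distrib_left sum_distrib_right
        by (simp add: mult_ac)
      also have "\<dots> = (\<Sum>a\<in>UNIV. if a = k
          then \<Sum>b\<in>UNIV. \<Sum>c\<in>UNIV. \<Sum>d\<in>UNIV. \<Sum>e\<in>UNIV. ?t a b c d e else 0)"
        by simp
      also have "\<dots> = (\<Sum>g\<in>UNIV. (\<Prod>i\<in>UNIV. A $ f i $ g i)
          * (if g 1 = k then x $ g 2 $ g 3 * y $ g 4 $ g 5 else 0))"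
        unfolding sum_fun5 by (intro sum.cong refl) (simp add: prod_5 mult.assoc)
      finally show ?thesis .
    qed
    from eps_contract_free_index[OF this]
    have "(wedge (A ** x ** transpose A) (A ** y ** transpose A) v* A) $ k = det A * wedge x y $ k"
      by (simp add: wedge_def)
  }
  thus ?thesis by (simp add: vec_eq_iff)
qed

definition quintic ::
  "complex^5^5 \<Rightarrow> complex^5^5 \<Rightarrow> complex^5^5 \<Rightarrow> complex^5^5 \<Rightarrow> complex^5^5 \<Rightarrow> complex" where
  "quintic x y z u v = (\<Sum>a\<in>UNIV. \<Sum>b\<in>UNIV. wedge x y $ a * wedge u v $ b * z $ a $ b)"

text \<open>
  The covectors transform by the inverse transpose of \<open>A\<close> and \<open>z\<close> by \<open>A\<close>, so \<open>A\<close> moves across the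
  pairing and cancels.
\<close>

lemma quintic_congruence:
  assumes "det A = 1"
  shows "quintic (A ** x ** transpose A) (A ** y ** transpose A) (A ** z ** transpose A)
           (A ** u ** transpose A) (A ** v ** transpose A) = quintic x y z u v"
proof -
  have pair: "(\<Sum>a\<in>UNIV. \<Sum>b\<in>UNIV. p $ a * q $ b * (A ** z ** transpose A) $ a $ b)
      = (\<Sum>c\<in>UNIV. \<Sum>d\<in>UNIV. (p v* A) $ c * (q v* A) $ d * z $ c $ d)" for p q
  proof -
    have form: "(\<Sum>a\<in>UNIV. \<Sum>b\<in>UNIV. p $ a * q $ b * M $ a $ b) = (\<Sum>a\<in>UNIV. p $ a * (M *v q) $ a)"
      for M :: "complex^5^5" and p q
      by (simp add: matrix_vector_mult_def sum_distrib_left mult_ac)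
    have adjoint: "(\<Sum>a\<in>UNIV. p $ a * (A *v r) $ a) = (\<Sum>c\<in>UNIV. (p v* A) $ c * r $ c)" for r
      unfolding matrix_vector_mult_def vector_matrix_mult_def vec_lambda_beta
        sum_distrib_left sum_distrib_right
      by (subst sum.swap) (simp add: mult_ac)
    have "(A ** z ** transpose A) *v q = A *v (z *v (q v* A))"
      by (simp add: matrix_vector_mul_assoc[symmetric])
    thus ?thesis by (simp add: form adjoint)
  qed
  show ?thesis
    unfolding quintic_def pair wedge_congruence by (simp add: assms)
qed

section \<open>The action of the second factor\<close>

lemma scalar_mat_entry: "(mat c ** M) $ a $ b = c * M $ a $ b" for M :: "complex^'m^'n"
  by (simp add: matrix_matrix_mult_def mat_def if_distrib if_distribR cong: if_cong)

definition mix :: "complex^'k^'k \<Rightarrow> complex^'m^'n^'k \<Rightarrow> complex^'m^'n^'k" where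
  "mix B X = (\<chi> k. \<Sum>j\<in>UNIV. mat (B $ k $ j) ** X $ j)"

lemma mix_entry: "mix B X $ k $ a $ b = (\<Sum>j\<in>UNIV. B $ k $ j * X $ j $ a $ b)"
  by (simp add: mix_def scalar_mat_entry)

lemma wedge_mix_left: "wedge (mix B X $ k) y $ i = (\<Sum>j\<in>UNIV. B $ k $ j * wedge (X $ j) y $ i)"
  unfolding wedge_def vec_lambda_beta mix_entry sum_distrib_left sum_distrib_right
  by (subst sum.swap) (simp add: mult_ac)

lemma wedge_mix_right: "wedge y (mix B X $ k) $ i = (\<Sum>j\<in>UNIV. B $ k $ j * wedge y (X $ j) $ i)"
  unfolding wedge_def vec_lambda_beta mix_entry sum_distrib_left sum_distrib_right
  by (subst sum.swap) (simp add: mult_ac)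

lemma quintic_mix:
  "quintic (mix B X $ k) y z u v = (\<Sum>j\<in>UNIV. B $ k $ j * quintic (X $ j) y z u v)"
  "quintic y (mix B X $ k) z u v = (\<Sum>j\<in>UNIV. B $ k $ j * quintic y (X $ j) z u v)"
  "quintic y z (mix B X $ k) u v = (\<Sum>j\<in>UNIV. B $ k $ j * quintic y z (X $ j) u v)"
  "quintic y z u (mix B X $ k) v = (\<Sum>j\<in>UNIV. B $ k $ j * quintic y z u (X $ j) v)"
  "quintic y z u v (mix B X $ k) = (\<Sum>j\<in>UNIV. B $ k $ j * quintic y z u v (X $ j))"
  unfolding quintic_def wedge_mix_left wedge_mix_right mix_entry
    sum_distrib_left sum_distrib_right sum.swap[where A = "UNIV :: 5 set" and B = "UNIV :: 'a set"]
  by (simp_all add: mult_ac)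

text \<open>
  The slots \<open>x\<close> and \<open>y\<close> are kept separate from \<open>X\<close>, because the volume form of $\mathbf{C}^4$ takes
  care of the three contracted occurrences of \<open>X\<close> only; these two slots are afterwards expanded by
  linearity.
\<close>

definition quintic_vec :: "complex^5^5^4 \<Rightarrow> complex^5^5 \<Rightarrow> complex^5^5 \<Rightarrow> complex^4" where
  "quintic_vec X x y
     = (\<chi> m. \<Sum>f | f 1 = m. eps f * quintic x (X $ f 2) (X $ f 3) y (X $ f 4))"

lemma quintic_vec_mix: "quintic_vec (mix B X) x y v* B = det B *s quintic_vec X x y"
proof -
  { fix n
    have "quintic x (mix B X $ f 2) (mix B X $ f 3) y (mix B X $ f 4) * B $ f 1 $ n
      = (\<Sum>g\<in>UNIV. (\<Prod>i\<in>UNIV. B $ f i $ g i)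
           * (if g 1 = n then quintic x (X $ g 2) (X $ g 3) y (X $ g 4) else 0))" for f :: "4 \<Rightarrow> 4"
    proof -
      let ?t = "\<lambda>a b c d. B $ f 1 $ a * (B $ f 2 $ b * (B $ f 3 $ c * B $ f 4 $ d))
            * quintic x (X $ b) (X $ c) y (X $ d)"
      have "quintic x (mix B X $ f 2) (mix B X $ f 3) y (mix B X $ f 4) * B $ f 1 $ n
          = (\<Sum>b\<in>UNIV. \<Sum>c\<in>UNIV. \<Sum>d\<in>UNIV. ?t n b c d)"
        unfolding quintic_mix(2) unfolding quintic_mix(3) unfolding quintic_mix(5)
        by (simp add: sum_distrib_left sum_distrib_right mult_ac)
      also have "\<dots> = (\<Sum>a\<in>UNIV. if a = n then \<Sum>b\<in>UNIV. \<Sum>c\<in>UNIV. \<Sum>d\<in>UNIV. ?t a b c d else 0)"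
        by simp
      also have "\<dots> = (\<Sum>g\<in>UNIV. (\<Prod>i\<in>UNIV. B $ f i $ g i)
          * (if g 1 = n then quintic x (X $ g 2) (X $ g 3) y (X $ g 4) else 0))"
        unfolding sum_fun4 by (intro sum.cong refl) (simp add: prod_4 mult.assoc)
      finally show ?thesis .
    qed
    from eps_contract_free_index[OF this]
    have "(quintic_vec (mix B X) x y v* B) $ n = det B * quintic_vec X x y $ n"
      by (simp add: quintic_vec_def)
  }
  thus ?thesis by (simp add: vec_eq_iff)
qed

lemma quintic_vec_linear:
  "quintic_vec X (mix B Y $ k) y $ m = (\<Sum>j\<in>UNIV. B $ k $ j * quintic_vec X (Y $ j) y $ m)"
  "quintic_vec X y (mix B Y $ k) $ m = (\<Sum>j\<in>UNIV. B $ k $ j * quintic_vec X y (Y $ j) $ m)"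
  unfolding quintic_vec_def vec_lambda_beta quintic_mix sum_distrib_left
  by (subst sum.swap, simp add: mult_ac)+

definition quintic_mat :: "complex^5^5^4 \<Rightarrow> 4 \<Rightarrow> complex^4^4" where
  "quintic_mat X i = (\<chi> j. quintic_vec X (X $ i) (X $ j))"

text \<open>
  The row index $j$ of $\Psi_i$ is a lower index and transforms by $B$, the column index is an upper
  one and transforms by the inverse of $B$. Hence $\Psi_i$ is conjugated, and the first index
  $i$ only forms linear combinations.
\<close>

lemma quintic_mat_mix:
  "quintic_mat (mix B X) i ** B
     = mat (det B) ** (\<Sum>i'\<in>UNIV. mat (B $ i $ i') ** (B ** quintic_mat X i'))"
proof -
  { fix j n
    have "(quintic_mat (mix B X) i ** B) $ j $ n
        = (quintic_vec (mix B X) (mix B X $ i) (mix B X $ j) v* B) $ n"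
      by (simp add: quintic_mat_def matrix_matrix_mult_def vector_matrix_mult_def)
    also have "\<dots> = det B * (\<Sum>i'\<in>UNIV. B $ i $ i' *
        (\<Sum>j'\<in>UNIV. B $ j $ j' * quintic_mat X i' $ j' $ n))"
      by (simp add: quintic_vec_mix quintic_vec_linear(1)[of X _ _ i])
        (simp add: quintic_vec_linear(2) quintic_mat_def)
    also have "\<dots> = (mat (det B) **
        (\<Sum>i'\<in>UNIV. mat (B $ i $ i') ** (B ** quintic_mat X i'))) $ j $ n"
      by (simp add: scalar_mat_entry) (simp add: matrix_matrix_mult_def)
    finally have "(quintic_mat (mix B X) i ** B) $ j $ n = (mat (det B) **
        (\<Sum>i'\<in>UNIV. mat (B $ i $ i') ** (B ** quintic_mat X i'))) $ j $ n" .
  }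
  thus ?thesis by (simp add: vec_eq_iff)
qed

section \<open>The covariant of degree ten\<close>

definition covariant :: "complex^5^5^4 \<Rightarrow> complex^4^4" where
  "covariant X = (\<chi> i j. trace (quintic_mat X i ** quintic_mat X j))"

lemma covariant_entry:
  "covariant X $ i $ j = (\<Sum>a\<in>UNIV. \<Sum>b\<in>UNIV. quintic_mat X i $ a $ b * quintic_mat X j $ b $ a)"
  by (simp add: covariant_def trace_def matrix_matrix_mult_def)

lemma transpose_covariant: "transpose (covariant X) = covariant X"
  unfolding vec_eq_iff transpose_def covariant_def vec_lambda_beta
  by (intro allI trace_mul_sym)

lemma sum_matrix_mult:
  fixes P :: "'i \<Rightarrow> complex^'m^'n" and R :: "complex^'l^'m"
  shows "sum P S ** R = (\<Sum>i\<in>S. P i ** R)"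
  by (simp add: vec_eq_iff matrix_matrix_mult_def sum_distrib_right) (subst sum.swap, simp)

lemma trace_product_sum:
  fixes P Q :: "'k \<Rightarrow> complex^'n^'n"
  shows "trace ((\<Sum>i\<in>S. mat (c i) ** P i) ** (\<Sum>j\<in>T. mat (d j) ** Q j))
     = (\<Sum>i\<in>S. \<Sum>j\<in>T. c i * d j * trace (P i ** Q j))"
proof -
  have trace_sum: "trace (\<Sum>i\<in>S. mat (c i) ** P i) = (\<Sum>i\<in>S. c i * trace (P i))"
    for c and S and P :: "'k \<Rightarrow> complex^'n^'n"
    by (simp add: trace_def scalar_mat_entry sum_distrib_left, subst sum.swap, simp)
  have left: "trace ((\<Sum>i\<in>S. mat (c i) ** P i) ** R) = (\<Sum>i\<in>S. c i * trace (P i ** R))"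
    for c and S and P :: "'k \<Rightarrow> complex^'n^'n" and R
    by (simp add: sum_matrix_mult trace_sum flip: matrix_mul_assoc)
  show ?thesis
    unfolding left trace_mul_sym[of _ "\<Sum>j\<in>T. mat (d j) ** Q j"]
    unfolding left trace_mul_sym[of "Q _"] sum_distrib_left
    by (subst sum.swap) (simp add: mult_ac)
qed

lemma covariant_mix:
  assumes "invertible B"
  shows "covariant (mix B X) = mat ((det B)\<^sup>2) ** (B ** covariant X ** transpose B)"
proof -
  obtain C where C: "B ** C = mat 1" "C ** B = mat 1" using assms by (auto simp: invertible_def)
  have mixed: "quintic_mat (mix B X) i
      = (\<Sum>i'\<in>UNIV. mat (det B * B $ i $ i') ** (B ** quintic_mat X i' ** C))" for i
  proof -
    have "quintic_mat (mix B X) i = quintic_mat (mix B X) i ** B ** C"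
      by (simp add: C flip: matrix_mul_assoc)
    also have "\<dots> = (\<Sum>i'\<in>UNIV. mat (det B * B $ i $ i') ** (B ** quintic_mat X i' ** C))"
      unfolding quintic_mat_mix
      by (simp add: vec_eq_iff scalar_mat_entry matrix_mul_assoc[symmetric] sum_matrix_mult
          sum_distrib_left mult.assoc)
    finally show ?thesis .
  qed
  have conj: "trace ((B ** P ** C) ** (B ** Q ** C)) = trace (P ** Q)" for P Q
  proof -
    have "(B ** P ** C) ** (B ** Q ** C) = B ** (P ** ((C ** B) ** Q) ** C)"
      by (simp only: matrix_mul_assoc)
    \<comment> \<open>Cyclicity of the trace brings the outer factors together.\<close>
    also have "trace \<dots> = trace (P ** Q ** (C ** B))"
      by (subst trace_mul_sym) (simp add: C flip: matrix_mul_assoc)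
    finally show ?thesis by (simp add: C)
  qed
  show ?thesis
    by (simp add: vec_eq_iff scalar_mat_entry congruence_entry covariant_def mixed
        trace_product_sum conj sum_distrib_left power2_eq_square mult_ac)
qed

lemma covariant_congruence:
  "det A = 1 \<Longrightarrow> covariant (\<chi> k. A ** X $ k ** transpose A) = covariant X"
  by (simp add: covariant_def quintic_mat_def quintic_vec_def quintic_congruence)

lemma rho_eq_mix: "rho A B X = mix B (\<chi> k. A ** X $ k ** transpose A)"
  by (simp add: rho_def mix_def)

lemma complex_polynomial_function_sum:
  assumes "\<And>i. i \<in> S \<Longrightarrow> complex_polynomial_function (f i)"
  shows "complex_polynomial_function (\<lambda>X. \<Sum>i\<in>S. f i X)"
  using assms
  by (induction S rule: infinite_finite_induct) (auto intro: complex_polynomial_function.intros)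

lemma complex_polynomial_function_wedge:
  "complex_polynomial_function (\<lambda>X. wedge (X $ k) (X $ l) $ a)"
  unfolding wedge_def vec_lambda_beta
  by (intro complex_polynomial_function.intros complex_polynomial_function_sum)

lemma complex_polynomial_function_covariant:
  "complex_polynomial_function (\<lambda>X. covariant X $ i $ j)"
  unfolding covariant_entry quintic_mat_def quintic_vec_def quintic_def vec_lambda_beta
  by (intro complex_polynomial_function.intros complex_polynomial_function_sum
      complex_polynomial_function_wedge)

section \<open>A quadruple on which the covariant does not vanish\<close>

lemma eps_tup4_zero: "\<not> distinct [a, b, c, d] \<Longrightarrow> eps (tup4 a b c d) = 0"
  using eps_not_inj[of "tup4 a b c d" 1 2] eps_not_inj[of "tup4 a b c d" 1 3]
    eps_not_inj[of "tup4 a b c d" 1 4] eps_not_inj[of "tup4 a b c d" 2 3]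
    eps_not_inj[of "tup4 a b c d" 2 4] eps_not_inj[of "tup4 a b c d" 3 4] by (simp, blast)

lemma eps_tup5_zero: "\<not> distinct [a, b, c, d, e] \<Longrightarrow> eps (tup5 a b c d e) = 0"
  using eps_not_inj[of "tup5 a b c d e" 1 2] eps_not_inj[of "tup5 a b c d e" 1 3]
    eps_not_inj[of "tup5 a b c d e" 1 4] eps_not_inj[of "tup5 a b c d e" 1 5]
    eps_not_inj[of "tup5 a b c d e" 2 3] eps_not_inj[of "tup5 a b c d e" 2 4]
    eps_not_inj[of "tup5 a b c d e" 2 5] eps_not_inj[of "tup5 a b c d e" 3 4]
    eps_not_inj[of "tup5 a b c d e" 3 5] eps_not_inj[of "tup5 a b c d e" 4 5] by (simp, blast)

lemma eps_tup4_swap: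
  shows "eps (tup4 b a c d) = - eps (tup4 a b c d)"
    and "eps (tup4 a c b d) = - eps (tup4 a b c d)"
    and "eps (tup4 a b d c) = - eps (tup4 a b c d)"
  subgoal by (rule eps_swap[of 1 2]; simp add: forall_4)
  subgoal by (rule eps_swap[of 2 3]; simp add: forall_4)
  subgoal by (rule eps_swap[of 3 4]; simp add: forall_4)
  done

lemma eps_tup5_swap:
  shows "eps (tup5 b a c d e) = - eps (tup5 a b c d e)"
    and "eps (tup5 a c b d e) = - eps (tup5 a b c d e)"
    and "eps (tup5 a b d c e) = - eps (tup5 a b c d e)"
    and "eps (tup5 a b c e d) = - eps (tup5 a b c d e)"
  subgoal by (rule eps_swap[of 1 2]; simp add: forall_5)
  subgoal by (rule eps_swap[of 2 3]; simp add: forall_5)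
  subgoal by (rule eps_swap[of 3 4]; simp add: forall_5)
  subgoal by (rule eps_swap[of 4 5]; simp add: forall_5)
  done

text \<open>
  The premises make antisymmetry a terminating rewrite system that sorts concrete index tuples.
  The order on a numeral type is not decided by simplification, hence the ranks in the natural
  numbers.
\<close>

lemma eps_tup4_sort:
  fixes a b c d :: 4
  defines "pos \<equiv> tup4 1 2 3 (4::nat)"
  shows "pos a > pos b \<Longrightarrow> eps (tup4 a b c d) = - eps (tup4 b a c d)"
    and "pos b > pos c \<Longrightarrow> eps (tup4 a b c d) = - eps (tup4 a c b d)"
    and "pos c > pos d \<Longrightarrow> eps (tup4 a b c d) = - eps (tup4 a b d c)"
  by (rule eps_tup4_swap)+

lemma eps_tup5_sort:
  fixes a b c d e :: 5
  defines "pos \<equiv> tup5 1 2 3 4 (5::nat)"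
  shows "pos a > pos b \<Longrightarrow> eps (tup5 a b c d e) = - eps (tup5 b a c d e)"
    and "pos b > pos c \<Longrightarrow> eps (tup5 a b c d e) = - eps (tup5 a c b d e)"
    and "pos c > pos d \<Longrightarrow> eps (tup5 a b c d e) = - eps (tup5 a b d c e)"
    and "pos d > pos e \<Longrightarrow> eps (tup5 a b c d e) = - eps (tup5 a b c e d)"
  by (rule eps_tup5_swap)+

lemma eps_tup_id: "eps (tup4 1 2 3 4) = 1" "eps (tup5 1 2 3 4 5) = 1"
  unfolding tup4_eta[of "\<lambda>i. i"] tup5_eta[of "\<lambda>i. i"] by (rule eps_id)+

text \<open>The matrix of $e_u \wedge e_v$.\<close>

definition skew_unit :: "'n::finite \<Rightarrow> 'n \<Rightarrow> complex^'n^'n" where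
  "skew_unit u v = (\<chi> a b. of_bool (a = u \<and> b = v) - of_bool (a = v \<and> b = u))"

lemma transpose_skew_unit: "transpose (skew_unit u v) = - skew_unit u v"
  unfolding vec_eq_iff transpose_def skew_unit_def vec_lambda_beta vector_uminus_component
    minus_diff_eq
  by (intro allI) (simp only: conj_commute)

lemma sum_skew_unit:
  fixes u v :: "'n::finite"
  shows "(\<Sum>a\<in>UNIV. \<Sum>b\<in>UNIV. G a b * skew_unit u v $ a $ b) = G u v - G v u"
proof -
  have "(\<Sum>a\<in>UNIV. \<Sum>b\<in>UNIV. G a b * skew_unit u v $ a $ b)
     = (\<Sum>a\<in>UNIV. if a = u then \<Sum>b\<in>UNIV. if b = v then G a b else 0 else 0)
     - (\<Sum>a\<in>UNIV. if a = v then \<Sum>b\<in>UNIV. if b = u then G a b else 0 else 0)"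
    unfolding sum_subtractf[symmetric]
    by (intro sum.cong refl)
      (auto simp: skew_unit_def right_diff_distrib sum_subtractf if_distrib cong: if_cong)
  thus ?thesis by simp
qed

lemma wedge_skew_unit: "wedge (skew_unit u v) (skew_unit w z) $ i = 4 * eps (tup5 i u v w z)"
proof -
  have "wedge (skew_unit u v) (skew_unit w z) $ i
    = (\<Sum>b\<in>UNIV. \<Sum>c\<in>UNIV. (\<Sum>d\<in>UNIV. \<Sum>e\<in>UNIV. eps (tup5 i b c d e) * skew_unit w z $ d $ e)
        * skew_unit u v $ b $ c)"
    unfolding wedge_def vec_lambda_beta
    by (simp add: sum_fun5_fibre sum_distrib_right sum_distrib_left mult_ac)
  also have "\<dots> = 4 * eps (tup5 i u v w z)"
    unfolding sum_skew_unit
    by (simp add: eps_tup5_swap(2)[of i v u] eps_tup5_swap(4)[of i _ _ z w])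
  finally show ?thesis .
qed

definition sample :: "complex^5^5^4" where
  "sample = (\<chi> k. tup4 (skew_unit 2 3) (skew_unit 3 1) (skew_unit 1 2) (skew_unit 4 5) k)"

lemma sample_simps:
  "sample $ 1 = skew_unit 2 3" "sample $ 2 = skew_unit 3 1"
  "sample $ 3 = skew_unit 1 2" "sample $ 4 = skew_unit 4 5"
  by (simp_all add: sample_def)

lemma sample_in_Alt5_4: "sample \<in> Alt5_4"
  by (simp add: Alt5_4_def forall_4 sample_simps transpose_skew_unit)

text \<open>
  The first three components are products of two of $e_1, e_2, e_3$, and any two of them
  share a vector, so only products with the fourth survive. The tuple converts the number $k$ of a
  component into the corresponding coordinate of $\mathbf{C}^5$.
\<close>

lemma wedge_sample:
  "wedge (sample $ k) (sample $ l) $ a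
     = (if (k = 4) = (l = 4) then 0
        else 4 * of_bool (a = tup4 1 2 3 4 (if k = 4 then l else k)))"
proof -
  have "\<forall>k l a. wedge (sample $ k) (sample $ l) $ a
     = (if (k = 4) = (l = 4) then 0
        else 4 * of_bool (a = tup4 1 2 3 4 (if k = 4 then l else k)))"
    unfolding forall_4 forall_5
    by (simp add: sample_simps wedge_skew_unit eps_tup5_zero eps_tup5_sort eps_tup_id)
  thus ?thesis by blast
qed

lemma quintic_sample:
  "quintic x y (sample $ 1) u v = wedge x y $ 2 * wedge u v $ 3 - wedge x y $ 3 * wedge u v $ 2"
  "quintic x y (sample $ 2) u v = wedge x y $ 3 * wedge u v $ 1 - wedge x y $ 1 * wedge u v $ 3"
  "quintic x y (sample $ 3) u v = wedge x y $ 1 * wedge u v $ 2 - wedge x y $ 2 * wedge u v $ 1"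
  "quintic x y (sample $ 4) u v = wedge x y $ 4 * wedge u v $ 5 - wedge x y $ 5 * wedge u v $ 4"
  by (simp_all add: quintic_def sum_skew_unit sample_simps)

lemma quintic_mat_sample:
  "quintic_mat sample 4 $ j $ m = (if j = m then if j = 4 then 96 else - 32 else 0)"
proof -
  have "quintic_mat sample 4 $ j $ m = (\<Sum>b\<in>UNIV. \<Sum>c\<in>UNIV. \<Sum>d\<in>UNIV. eps (tup4 m b c d)
      * quintic (sample $ 4) (sample $ b) (sample $ c) (sample $ j) (sample $ d))" for j m
    by (simp add: quintic_mat_def quintic_vec_def sum_fun4_fibre)
  hence "\<forall>j m. quintic_mat sample 4 $ j $ m = (if j = m then if j = 4 then 96 else - 32 else 0)"
    unfolding sum_4 forall_4
    by (simp add: quintic_sample wedge_sample eps_tup4_zero eps_tup4_sort eps_tup_id)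
  thus ?thesis by blast
qed

lemma covariant_sample: "covariant sample $ 4 $ 4 = 12288"
  by (simp add: covariant_entry quintic_mat_sample sum_4)

theorem proposition2p1:
  shows "\<exists>\<Phi> :: complex^5^5^4 \<Rightarrow> complex^4^4.
    polynomial_map_Alt5_4_Sym4 \<Phi> \<and>
    (\<exists>X\<in>Alt5_4. \<Phi> X \<noteq> 0) \<and>
    (\<forall>X\<in>Alt5_4. \<forall>A\<in>SL5. \<forall>B\<in>GL4.
       \<Phi> (rho A B X) = mat ((det B)\<^sup>2) ** (B ** \<Phi> X ** transpose B))"
proof (intro exI conjI)
  show "polynomial_map_Alt5_4_Sym4 covariant"
    unfolding polynomial_map_Alt5_4_Sym4_def
    using complex_polynomial_function_covariant by (fastforce simp: Sym4_def transpose_covariant)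
  have "covariant sample \<noteq> 0"
    using covariant_sample by auto
  thus "\<exists>X\<in>Alt5_4. covariant X \<noteq> 0"
    using sample_in_Alt5_4 by blast
  show "\<forall>X\<in>Alt5_4. \<forall>A\<in>SL5. \<forall>B\<in>GL4.
      covariant (rho A B X) = mat ((det B)\<^sup>2) ** (B ** covariant X ** transpose B)"
    by (simp add: rho_eq_mix covariant_mix covariant_congruence SL5_def GL4_def)
qed

end
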